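(* Let $(\mathcal M_n)_{n\in\mathbb N}$ be a sequence of von Neumann algebras, let $I$ be an index set, and for every $n$ let $\{\rho_{n,i}\}_{i\in I}$ and $S_n$ be sets of states on $\mathcal M_n$; let $H_1:(S_n)_{n\in\mathbb N}$. Assume that there exists a countable $\tilde I\subseteq I$ such that for every $i\in I$ and every $\varepsilon>0$ there exist $k_{i,\varepsilon}\in\tilde I$ and $N_{i,\varepsilon}\in\mathbb N$ such that $\frac1nD_\infty^*(\rho_{n,k_{i,\varepsilon}}\|\rho_{n,i})\le\varepsilon$ for every $n\ge N_{i,\varepsilon}$. Then for every $r>0$, $$\inf_{r'>r}\,\sup_{i\in\tilde I}\,\mathrm{sc}_{r'}\big((\rho_{n,i})_{n}\,\|\,H_1\big)\ \ge\ \mathrm{sc}_r^{\{0\}}\big((\{\rho_{n,i}\}_{i\in I})_{n}\,\|\,H_1\big)\ \ge\ \sup_{i\in I}\mathrm{sc}_r\big((\rho_{n,i})_{n}\,\|\,H_1\big).$$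
   Context: A state on a von Neumann algebra is a normal positive linear functional $\rho$ with $\rho(I)=1$; a test in $\mathcal M_n$ is $T_n\in\mathcal M_n$ with $0\le T_n\le I$. All sets of states are non-empty; $\log$ is natural and $-\log0=+\infty$. The max-relative entropy is $D_\infty^*(\rho\|\sigma)=\inf\{\lambda\in\mathbb R:\rho\le e^\lambda\sigma\}$ ($\inf\emptyset=+\infty$). Put $\beta_n(T_n)=\sup_{\sigma\in S_n}\sigma(T_n)$. For a single sequence of states $(\rho_n)_n$, $$\mathrm{sc}_r((\rho_n)_n\|H_1)=\inf\Big\{\limsup_{n}-\tfrac1n\log\rho_n(T_n):\ \liminf_{n}-\tfrac1n\log\beta_n(T_n)\ge r\Big\},$$ the infimum being over all test sequences satisfying the indicated condition. The relaxed exponent $\mathrm{sc}_r^{\{0\}}((\{\rho_{n,i}\}_{i\in I})_n\|H_1)$ is the infimum of $\sup_{i\in I}\limsup_n-\frac1n\log\rho_{n,i}(T_n)$ over all test sequences with $\liminf_n-\frac1n\log\beta_n(T_n)\ge r$. *)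

theory Defs
  imports "HOL-Analysis.Analysis"
begin

text \<open>
  Complex Hilbert spaces as a refinement of the real inner product spaces of the library.
  Positive definiteness of \<open>cinner\<close> follows from that of \<open>inner\<close>, since
  \<open>cinner x x\<close> is real. As in physics, \<open>cinner\<close> is linear in its second argument.
\<close>

class complex_hilbert = real_inner + complete_space +
  fixes scaleC :: "complex \<Rightarrow> 'a \<Rightarrow> 'a"  (infixr \<open>*\<^sub>C\<close> 75)
    and cinner :: "'a \<Rightarrow> 'a \<Rightarrow> complex"
  assumes scaleC_add_right: "c *\<^sub>C (x + y) = c *\<^sub>C x + c *\<^sub>C y"
    and scaleC_add_left: "(c + d) *\<^sub>C x = c *\<^sub>C x + d *\<^sub>C x"
    and scaleC_scaleC: "c *\<^sub>C d *\<^sub>C x = (c * d) *\<^sub>C x"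
    and scaleC_of_real: "complex_of_real r *\<^sub>C x = r *\<^sub>R x"
    and cinner_commute: "cinner x y = cnj (cinner y x)"
    and cinner_add_right: "cinner x (y + z) = cinner x y + cinner x z"
    and cinner_scaleC_right: "cinner x (c *\<^sub>C y) = c * cinner x y"
    and inner_eq_Re_cinner: "x \<bullet> y = Re (cinner x y)"

instantiation complex :: complex_hilbert
begin

definition scaleC_complex :: "complex \<Rightarrow> complex \<Rightarrow> complex"
  where "scaleC_complex = (*)"

definition cinner_complex :: "complex \<Rightarrow> complex \<Rightarrow> complex"
  where "cinner_complex x y = cnj x * y"

instance
  by standard
    (simp_all add: scaleC_complex_def cinner_complex_def algebra_simps scaleR_conv_of_real
      inner_complex_def)

end

text \<open>
  In order to speak about a sequence of Hilbert spaces, we take each of them to be a closed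
  complex subspace of an ambient Hilbert space. This is no restriction: all members of a given
  sequence of Hilbert spaces embed isometrically as closed subspaces of their direct sum.
\<close>

definition closed_csubspace :: "'h::complex_hilbert set \<Rightarrow> bool"
  where "closed_csubspace H \<longleftrightarrow>
    closed H \<and> 0 \<in> H \<and> (\<forall>x\<in>H. \<forall>y\<in>H. x + y \<in> H) \<and> (\<forall>c. \<forall>x\<in>H. c *\<^sub>C x \<in> H)"

text \<open>
  Operators on \<open>H\<close> are maps from \<open>H\<close> to \<open>H\<close>, extensional in the sense of \<open>FuncSet\<close>, so that
  equality of operators is equality on \<open>H\<close>; nothing outside of \<open>H\<close> is relevant.
\<close>

type_synonym 'h op = "'h \<Rightarrow> 'h"

definition bounded_ops :: "'h::complex_hilbert set \<Rightarrow> 'h op set"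
  where "bounded_ops H = {A \<in> H \<rightarrow>\<^sub>E H.
    (\<forall>x\<in>H. \<forall>y\<in>H. A (x + y) = A x + A y) \<and>
    (\<forall>c. \<forall>x\<in>H. A (c *\<^sub>C x) = c *\<^sub>C A x) \<and>
    (\<exists>K. \<forall>x\<in>H. norm (A x) \<le> K * norm x)}"

definition op_zero :: "'h::complex_hilbert set \<Rightarrow> 'h op"
  where "op_zero H = (\<lambda>x\<in>H. 0)"

definition op_id :: "'h::complex_hilbert set \<Rightarrow> 'h op"
  where "op_id H = (\<lambda>x\<in>H. x)"

definition op_add :: "'h::complex_hilbert set \<Rightarrow> 'h op \<Rightarrow> 'h op \<Rightarrow> 'h op"
  where "op_add H A B = (\<lambda>x\<in>H. A x + B x)"

definition op_scale :: "'h::complex_hilbert set \<Rightarrow> complex \<Rightarrow> 'h op \<Rightarrow> 'h op"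
  where "op_scale H c A = (\<lambda>x\<in>H. c *\<^sub>C A x)"

text \<open>The set \<open>\<real>\<^sub>\<ge>\<^sub>0\<close> below consists of the complex numbers that are real and nonnegative.\<close>

definition op_le :: "'h::complex_hilbert set \<Rightarrow> 'h op \<Rightarrow> 'h op \<Rightarrow> bool"
  where "op_le H A B \<longleftrightarrow> (\<forall>x\<in>H. cinner x (B x - A x) \<in> \<real>\<^sub>\<ge>\<^sub>0)"

definition commutant :: "'h::complex_hilbert set \<Rightarrow> 'h op set \<Rightarrow> 'h op set"
  where "commutant H X = {B \<in> bounded_ops H. \<forall>A\<in>X. compose H A B = compose H B A}"

text \<open>
  A von Neumann algebra is a set of bounded operators that is closed under adjoints and equal to
  its bicommutant; being a unital subalgebra is then automatic.
\<close>

definition von_neumann_algebra :: "'h::complex_hilbert set \<Rightarrow> 'h op set \<Rightarrow> bool"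
  where "von_neumann_algebra H M \<longleftrightarrow>
    closed_csubspace H \<and> M \<subseteq> bounded_ops H \<and>
    (\<forall>A\<in>M. \<exists>B\<in>M. \<forall>x\<in>H. \<forall>y\<in>H. cinner (A x) y = cinner x (B y)) \<and>
    commutant H (commutant H M) = M"

text \<open>Functionals on \<open>M\<close> are total functions of which only the values on \<open>M\<close> are relevant.\<close>

type_synonym 'h functional = "'h op \<Rightarrow> complex"

definition positive_linear_functional ::
    "'h::complex_hilbert set \<Rightarrow> 'h op set \<Rightarrow> 'h functional \<Rightarrow> bool"
  where "positive_linear_functional H M \<phi> \<longleftrightarrow>
    (\<forall>A\<in>M. \<forall>B\<in>M. \<phi> (op_add H A B) = \<phi> A + \<phi> B) \<and>
    (\<forall>c. \<forall>A\<in>M. \<phi> (op_scale H c A) = c * \<phi> A) \<and>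
    (\<forall>A\<in>M. op_le H (op_zero H) A \<longrightarrow> \<phi> A \<in> \<real>\<^sub>\<ge>\<^sub>0)"

text \<open>
  Normality: the functional preserves suprema of upward directed sets of positive elements that
  have a supremum in \<open>M\<close>.
\<close>

definition normal_functional ::
    "'h::complex_hilbert set \<Rightarrow> 'h op set \<Rightarrow> 'h functional \<Rightarrow> bool"
  where "normal_functional H M \<phi> \<longleftrightarrow>
    (\<forall>D B. D \<noteq> {} \<and> D \<subseteq> {A \<in> M. op_le H (op_zero H) A} \<and>
       (\<forall>A1\<in>D. \<forall>A2\<in>D. \<exists>A3\<in>D. op_le H A1 A3 \<and> op_le H A2 A3) \<and>
       B \<in> M \<and> (\<forall>A\<in>D. op_le H A B) \<and>
       (\<forall>C\<in>M. (\<forall>A\<in>D. op_le H A C) \<longrightarrow> op_le H B C)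
     \<longrightarrow> Re (\<phi> B) = (SUP A\<in>D. Re (\<phi> A)))"

definition is_state :: "'h::complex_hilbert set \<Rightarrow> 'h op set \<Rightarrow> 'h functional \<Rightarrow> bool"
  where "is_state H M \<rho> \<longleftrightarrow>
    positive_linear_functional H M \<rho> \<and> normal_functional H M \<rho> \<and> \<rho> (op_id H) = 1"

definition is_test :: "'h::complex_hilbert set \<Rightarrow> 'h op set \<Rightarrow> 'h op \<Rightarrow> bool"
  where "is_test H M T \<longleftrightarrow> T \<in> M \<and> op_le H (op_zero H) T \<and> op_le H T (op_id H)"

definition functional_le ::
    "'h::complex_hilbert set \<Rightarrow> 'h op set \<Rightarrow> 'h functional \<Rightarrow> 'h functional \<Rightarrow> bool"
  where "functional_le H M \<phi> \<psi> \<longleftrightarrow>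
    (\<forall>A\<in>M. op_le H (op_zero H) A \<longrightarrow> \<psi> A - \<phi> A \<in> \<real>\<^sub>\<ge>\<^sub>0)"

definition D_max ::
    "'h::complex_hilbert set \<Rightarrow> 'h op set \<Rightarrow> 'h functional \<Rightarrow> 'h functional \<Rightarrow> ereal"
  where "D_max H M \<rho> \<sigma> =
    Inf {ereal l | l. functional_le H M \<rho> (\<lambda>A. complex_of_real (exp l) * \<sigma> A)}"

definition neg_log :: "real \<Rightarrow> ereal"
  where "neg_log x = (if x = 0 then \<infinity> else ereal (- ln x))"

definition beta :: "'h functional set \<Rightarrow> 'h op \<Rightarrow> real"
  where "beta S T = (SUP \<sigma>\<in>S. Re (\<sigma> T))"

text \<open>
  The sequences whose second-kind error decays with rate at least \<open>r\<close>. In this and the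
  following definitions the term for \<open>n = 0\<close>, where \<open>1 / n\<close> is meaningless, does not affect
  the value of \<open>liminf\<close> and \<open>limsup\<close>.
\<close>

definition rate_tests ::
    "(nat \<Rightarrow> 'h::complex_hilbert set) \<Rightarrow> (nat \<Rightarrow> 'h op set) \<Rightarrow> (nat \<Rightarrow> 'h functional set) \<Rightarrow>
      real \<Rightarrow> (nat \<Rightarrow> 'h op) set"
  where "rate_tests H M S r =
    {T. (\<forall>n. is_test (H n) (M n) (T n)) \<and>
        liminf (\<lambda>n. ereal (1 / real n) * neg_log (beta (S n) (T n))) \<ge> ereal r}"

definition success_exponent :: "(nat \<Rightarrow> 'h functional) \<Rightarrow> (nat \<Rightarrow> 'h op) \<Rightarrow> ereal"
  where "success_exponent \<rho> T = limsup (\<lambda>n. ereal (1 / real n) * neg_log (Re (\<rho> n (T n))))"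

definition sc ::
    "(nat \<Rightarrow> 'h::complex_hilbert set) \<Rightarrow> (nat \<Rightarrow> 'h op set) \<Rightarrow> real \<Rightarrow>
      (nat \<Rightarrow> 'h functional) \<Rightarrow> (nat \<Rightarrow> 'h functional set) \<Rightarrow> ereal"
  where "sc H M r \<rho> S = (INF T\<in>rate_tests H M S r. success_exponent \<rho> T)"

definition sc_relaxed ::
    "(nat \<Rightarrow> 'h::complex_hilbert set) \<Rightarrow> (nat \<Rightarrow> 'h op set) \<Rightarrow> real \<Rightarrow>
      'i set \<Rightarrow> (nat \<Rightarrow> 'i \<Rightarrow> 'h functional) \<Rightarrow> (nat \<Rightarrow> 'h functional set) \<Rightarrow> ereal"
  where "sc_relaxed H M r I \<rho> S =
    (INF T\<in>rate_tests H M S r. SUP i\<in>I. success_exponent (\<lambda>n. \<rho> n i) T)"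

end

theory Submission
  imports Defs "HOL-Real_Asymp.Real_Asymp"
begin

text \<open>
  For every \<open>k \<in> J\<close> take a test sequence \<open>T k\<close> of rate \<open>r' > r\<close> that is almost optimal for
  \<open>\<rho> k\<close>. At time \<open>n\<close>, average with weights \<open>1 / (n + 1)\<close> those of the first \<open>n + 1\<close> sequences
  whose second-kind error is already below \<open>exp (- n r)\<close>. The average still has rate \<open>r\<close>,
  every \<open>k \<in> J\<close> eventually takes part in it, and the weights cost nothing on the exponential
  scale. Domination of \<open>\<rho> k\<close> by \<open>exp (n \<epsilon>) \<rho> i\<close> transfers the success exponent from \<open>k\<close> to \<open>i\<close>.
\<close>

section \<open>Inner product and norm of a complex Hilbert space\<close>

lemma scaleC_0_left: "0 *\<^sub>C (x::'h::complex_hilbert) = 0"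
  using scaleC_of_real[of 0 x] by simp

lemma cinner_0_right: "cinner x (0::'h::complex_hilbert) = 0"
  using cinner_scaleC_right[of x 0 x] by (simp add: scaleC_0_left)

lemma cinner_scaleR_right: "cinner x (a *\<^sub>R (y::'h::complex_hilbert)) = of_real a * cinner x y"
  by (metis cinner_scaleC_right scaleC_of_real)

lemma cinner_diff_right: "cinner x (y - (z::'h::complex_hilbert)) = cinner x y - cinner x z"
  using cinner_add_right[of x "y - z" z] by simp

lemma cinner_sum_right: "cinner x (\<Sum>k\<in>K. f k :: 'h::complex_hilbert) = (\<Sum>k\<in>K. cinner x (f k))"
  by (induction K rule: infinite_finite_induct) (simp_all add: cinner_0_right cinner_add_right)

lemma cinner_self_nonneg: "cinner x (x::'h::complex_hilbert) \<in> \<real>\<^sub>\<ge>\<^sub>0"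
proof -
  \<comment> \<open>Conjugate symmetry makes \<open>cinner x x\<close> equal to its own conjugate,
    hence real.\<close>
  have "Im (cinner x x) = - Im (cinner x x)"
    using cinner_commute[of x x] by (metis cnj.simps(2))
  then show ?thesis
    by (auto simp: complex_nonneg_Reals_iff simp flip: inner_eq_Re_cinner)
qed

text \<open>The class axioms tie the norm to real scalars only. For complex ones,
  \<open>cinner\<close> is conjugate-linear in its first argument, so the squared norm picks up the
  factor \<open>c * cnj c\<close>. This bounds scaled operators.\<close>

lemma norm_scaleC: "norm (c *\<^sub>C x) = cmod c * norm (x::'h::complex_hilbert)"
proof -
  have self: "cinner y y = of_real ((norm y)\<^sup>2)" for y :: 'h
    using cinner_self_nonneg[of y] inner_eq_Re_cinner[of y y]
    by (auto simp: complex_nonneg_Reals_iff complex_eq_iff power2_norm_eq_inner)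
  have "cinner (c *\<^sub>C x) x = cnj c * cinner x x"
    by (metis cinner_commute cinner_scaleC_right complex_cnj_mult)
  then have "cinner (c *\<^sub>C x) (c *\<^sub>C x) = (c * cnj c) * cinner x x"
    by (simp add: cinner_scaleC_right)
  also have "\<dots> = of_real ((cmod c * norm x)\<^sup>2)"
    unfolding self complex_norm_square[symmetric] by (simp add: power_mult_distrib)
  finally have "cinner (c *\<^sub>C x) (c *\<^sub>C x) = of_real ((cmod c * norm x)\<^sup>2)" .
  then have "(norm (c *\<^sub>C x))\<^sup>2 = (cmod c * norm x)\<^sup>2"
    by (metis self of_real_eq_iff)
  then show ?thesis by simp
qed

section \<open>Linear structure of bounded operators, commutants and von Neumann algebras\<close>

lemma op_id_in_bounded_ops: "closed_csubspace H \<Longrightarrow> op_id H \<in> bounded_ops H"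
  by (auto simp: bounded_ops_def op_id_def closed_csubspace_def intro!: exI[of _ 1])

lemma op_add_in_bounded_ops:
  assumes H: "closed_csubspace H" and A: "A \<in> bounded_ops H" and B: "B \<in> bounded_ops H"
  shows "op_add H A B \<in> bounded_ops H"
proof -
  obtain K where K: "\<And>x. x \<in> H \<Longrightarrow> norm (A x) \<le> K * norm x"
    using A unfolding bounded_ops_def by blast
  obtain L where L: "\<And>x. x \<in> H \<Longrightarrow> norm (B x) \<le> L * norm x"
    using B unfolding bounded_ops_def by blast
  have "norm (A x + B x) \<le> (K + L) * norm x" if "x \<in> H" for x
    using K[OF that] L[OF that] norm_triangle_ineq[of "A x" "B x"] by (simp add: algebra_simps)
  then show ?thesis
    using H A B unfolding bounded_ops_def op_add_def closed_csubspace_def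
    by (auto simp: scaleC_add_right PiE_iff intro!: exI[of _ "K + L"])
qed

lemma op_scale_in_bounded_ops:
  assumes H: "closed_csubspace H" and A: "A \<in> bounded_ops H"
  shows "op_scale H c A \<in> bounded_ops H"
proof -
  obtain K where K: "\<And>x. x \<in> H \<Longrightarrow> norm (A x) \<le> K * norm x"
    using A unfolding bounded_ops_def by blast
  have "norm (c *\<^sub>C A x) \<le> (cmod c * K) * norm x" if "x \<in> H" for x
    using mult_left_mono[OF K[OF that] norm_ge_zero[of c]] by (simp add: norm_scaleC mult_ac)
  then show ?thesis
    using H A unfolding bounded_ops_def op_scale_def closed_csubspace_def
    by (auto simp: scaleC_add_right scaleC_scaleC mult.commute PiE_iff intro!: exI[of _ "cmod c * K"])
qed

text \<open>Linearity of the elements of \<open>X\<close>, which comes from \<open>X\<close> lying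
  in \<open>bounded_ops H\<close>, lets them pass through sums and scalar multiples.\<close>

lemma commutant_closed:
  assumes H: "closed_csubspace H" and X: "X \<subseteq> bounded_ops H"
  shows op_id_in_commutant: "op_id H \<in> commutant H X"
    and op_add_in_commutant:
      "A \<in> commutant H X \<Longrightarrow> B \<in> commutant H X \<Longrightarrow> op_add H A B \<in> commutant H X"
    and op_scale_in_commutant: "A \<in> commutant H X \<Longrightarrow> op_scale H c A \<in> commutant H X"
proof -
  have XH: "C x \<in> H" if "C \<in> X" "x \<in> H" for C x
    using X that by (auto simp: bounded_ops_def PiE_iff subset_iff)
  show "op_id H \<in> commutant H X"
    using op_id_in_bounded_ops[OF H]
    by (auto simp: commutant_def compose_def op_id_def XH intro!: restrict_ext)
  show "op_add H A B \<in> commutant H X" if A: "A \<in> commutant H X" and B: "B \<in> commutant H X"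
  proof -
    have b: "A \<in> bounded_ops H" "B \<in> bounded_ops H" using A B by (auto simp: commutant_def)
    have "C (A x + B x) = A (C x) + B (C x)" if C: "C \<in> X" and x: "x \<in> H" for C x
    proof -
      have "C (A x) = A (C x)" "C (B x) = B (C x)"
        using A B C x unfolding commutant_def compose_def by (auto dest!: bspec fun_cong[of _ _ x])
      moreover have "C (A x + B x) = C (A x) + C (B x)"
        using X C b x by (auto simp: bounded_ops_def subset_iff PiE_iff)
      ultimately show ?thesis by simp
    qed
    then show ?thesis
      using op_add_in_bounded_ops[OF H b] X
      by (auto simp: commutant_def compose_def op_add_def XH intro!: restrict_ext)
  qed
  show "op_scale H c A \<in> commutant H X" if A: "A \<in> commutant H X"
  proof -
    have b: "A \<in> bounded_ops H" using A by (auto simp: commutant_def)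
    have "C (c *\<^sub>C A x) = c *\<^sub>C A (C x)" if C: "C \<in> X" and x: "x \<in> H" for C x
    proof -
      have "C (A x) = A (C x)"
        using A C x unfolding commutant_def compose_def by (auto dest!: bspec fun_cong[of _ _ x])
      moreover have "C (c *\<^sub>C A x) = c *\<^sub>C C (A x)"
        using X C b x by (auto simp: bounded_ops_def subset_iff PiE_iff)
      ultimately show ?thesis by simp
    qed
    then show ?thesis
      using op_scale_in_bounded_ops[OF H b] X
      by (auto simp: commutant_def compose_def op_scale_def XH intro!: restrict_ext)
  qed
qed

text \<open>The bicommutant condition presents \<open>M\<close> as the commutant of
  \<open>commutant H M\<close>, a set of bounded operators, so \<open>commutant_closed\<close>
  applies.\<close>

lemma von_neumann_algebra_closed:
  assumes "von_neumann_algebra H M"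
  shows op_id_in_vna: "op_id H \<in> M"
    and op_add_in_vna: "A \<in> M \<Longrightarrow> B \<in> M \<Longrightarrow> op_add H A B \<in> M"
    and op_scale_in_vna: "A \<in> M \<Longrightarrow> op_scale H c A \<in> M"
proof -
  have *: "closed_csubspace H" "commutant H M \<subseteq> bounded_ops H" "commutant H (commutant H M) = M"
    using assms by (auto simp: von_neumann_algebra_def commutant_def)
  show "op_id H \<in> M" "A \<in> M \<Longrightarrow> B \<in> M \<Longrightarrow> op_add H A B \<in> M" "A \<in> M \<Longrightarrow> op_scale H c A \<in> M"
    using commutant_closed[OF *(1,2)] *(3) by auto
qed

section \<open>States on tests, and weighted averages of tests\<close>

lemma state_nonneg:
  assumes "is_state H M \<rho>" and "is_test H M T"
  shows "0 \<le> Re (\<rho> T)"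
  using assms
  by (auto simp: is_state_def positive_linear_functional_def is_test_def complex_nonneg_Reals_iff)

lemma state_le_1:
  assumes M: "von_neumann_algebra H M" and \<rho>: "is_state H M \<rho>" and T: "is_test H M T"
  shows "Re (\<rho> T) \<le> 1"
proof -
  \<comment> \<open>The complementary test, identity minus \<open>T\<close>; positivity of the state
    on it gives the bound.\<close>
  let ?D = "op_add H (op_id H) (op_scale H (- 1) T)"
  have neg: "(- 1) *\<^sub>C x = - x" for x :: 'a
    using scaleC_of_real[of "- 1" x] by simp
  have TM: "T \<in> M" using T by (simp add: is_test_def)
  have "op_le H (op_zero H) ?D"
    using T by (auto simp: is_test_def op_le_def op_add_def op_scale_def op_id_def op_zero_def neg)
  moreover have "?D \<in> M"
    using TM von_neumann_algebra_closed[OF M] by simp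
  ultimately have "\<rho> ?D \<in> \<real>\<^sub>\<ge>\<^sub>0"
    using \<rho> by (simp only: is_state_def positive_linear_functional_def)
  moreover have "\<rho> ?D = 1 - \<rho> T"
    using \<rho> TM von_neumann_algebra_closed[OF M]
    by (simp add: is_state_def positive_linear_functional_def)
  ultimately show ?thesis by (simp add: complex_nonneg_Reals_iff)
qed

text \<open>A pointwise sum makes quadratic forms easy to compute; membership in the algebra and
  values of functionals are obtained by induction on \<open>K\<close> through \<open>op_add\<close>
  and \<open>op_scale\<close>.\<close>

definition op_lincomb ::
    "'h::complex_hilbert set \<Rightarrow> 'k set \<Rightarrow> ('k \<Rightarrow> real) \<Rightarrow> ('k \<Rightarrow> 'h op) \<Rightarrow> 'h op"
  where "op_lincomb H K p T = (\<lambda>x\<in>H. \<Sum>k\<in>K. p k *\<^sub>R T k x)"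

text \<open>Writing the zero operator as a multiple of the identity puts it in the algebra and shows
  that linear functionals vanish on it.\<close>

lemma op_lincomb_empty: "op_lincomb H {} p T = op_scale H 0 (op_id H)"
  by (auto simp: op_lincomb_def op_scale_def scaleC_0_left intro!: restrict_ext)

lemma op_lincomb_insert:
  assumes "finite K" and "k \<notin> K"
  shows "op_lincomb H (insert k K) p T =
    op_add H (op_scale H (of_real (p k)) (T k)) (op_lincomb H K p T)"
  using assms by (auto simp: op_lincomb_def op_scale_def op_add_def scaleC_of_real intro!: restrict_ext)

lemma op_lincomb_in_vna:
  assumes "von_neumann_algebra H M" and "finite K" and "\<And>k. k \<in> K \<Longrightarrow> T k \<in> M"
  shows "op_lincomb H K p T \<in> M"
  using assms(2,3)
  by (induction K rule: finite_induct)
    (simp_all add: op_lincomb_empty op_lincomb_insert von_neumann_algebra_closed[OF assms(1)])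

lemma positive_linear_functional_lincomb:
  assumes M: "von_neumann_algebra H M" and \<phi>: "positive_linear_functional H M \<phi>"
    and "finite K" and "\<And>k. k \<in> K \<Longrightarrow> T k \<in> M"
  shows "\<phi> (op_lincomb H K p T) = (\<Sum>k\<in>K. of_real (p k) * \<phi> (T k))"
  using assms(3,4)
proof (induction K rule: finite_induct)
  case empty
  then show ?case
    using \<phi> op_id_in_vna[OF M] by (simp add: op_lincomb_empty positive_linear_functional_def)
next
  case (insert k K)
  then show ?case
    using \<phi> op_lincomb_in_vna[OF M, of K T p] op_scale_in_vna[OF M]
    by (simp add: op_lincomb_insert positive_linear_functional_def)
qed

text \<open>Each quadratic form of \<open>T k\<close> lies between 0 and that of the identity, and
  so does a combination of total weight at most 1. The total may be smaller than 1: the missing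
  weight amounts to the zero test.\<close>

lemma is_test_op_lincomb:
  assumes M: "von_neumann_algebra H M" and K: "finite K"
    and T: "\<And>k. k \<in> K \<Longrightarrow> is_test H M (T k)"
    and p: "\<And>k. k \<in> K \<Longrightarrow> 0 \<le> p k" "sum p K \<le> 1"
  shows "is_test H M (op_lincomb H K p T)"
proof -
  have "cinner x (\<Sum>k\<in>K. p k *\<^sub>R T k x) \<in> \<real>\<^sub>\<ge>\<^sub>0 \<and>
      cinner x (x - (\<Sum>k\<in>K. p k *\<^sub>R T k x)) \<in> \<real>\<^sub>\<ge>\<^sub>0" if x: "x \<in> H" for x
  proof -
    let ?s = "cinner x (\<Sum>k\<in>K. p k *\<^sub>R T k x)"
    have s: "?s = (\<Sum>k\<in>K. of_real (p k) * cinner x (T k x))"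
      by (simp add: cinner_sum_right cinner_scaleR_right)
    have Tk: "Im (cinner x (T k x)) = 0" "0 \<le> Re (cinner x (T k x))"
      "Re (cinner x (T k x)) \<le> Re (cinner x x)" if "k \<in> K" for k
      using T[OF that] x
      by (auto simp: is_test_def op_le_def op_zero_def op_id_def cinner_diff_right
          complex_nonneg_Reals_iff)
    have xx: "0 \<le> Re (cinner x x)" "Im (cinner x x) = 0"
      using cinner_self_nonneg[of x] by (auto simp: complex_nonneg_Reals_iff)
    have "Im ?s = 0" "0 \<le> Re ?s" unfolding s by (simp_all add: Tk p sum_nonneg)
    moreover have "Re ?s \<le> (\<Sum>k\<in>K. p k * Re (cinner x x))"
      unfolding s by (simp add: Tk p sum_mono mult_left_mono)
    moreover have "\<dots> \<le> Re (cinner x x)"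
      using mult_right_mono[OF p(2) xx(1)] by (simp flip: sum_distrib_right)
    ultimately show ?thesis
      using xx by (simp add: complex_nonneg_Reals_iff cinner_diff_right)
  qed
  then show ?thesis
    using op_lincomb_in_vna[OF M K] T
    by (auto simp: is_test_def op_le_def op_zero_def op_id_def op_lincomb_def)
qed

section \<open>From exponents to exponential bounds\<close>

lemma neg_log_rate_ge_iff:
  assumes "0 < n" and "0 \<le> x"
  shows "ereal r \<le> ereal (1 / real n) * neg_log x \<longleftrightarrow> x \<le> exp (- (real n * r))"
proof (cases "x = 0")
  case False
  then have "0 < x" using assms by simp
  then show ?thesis
    using assms ln_le_cancel_iff[of x "exp (- (real n * r))"]
    by (auto simp: neg_log_def field_simps)
qed (use assms in \<open>simp add: neg_log_def\<close>)

text \<open>At \<open>x = 0\<close> the exponent is infinite because \<open>0 < n\<close>, so both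
  sides fail here, whereas both hold in the reverse comparison above.\<close>

lemma neg_log_rate_le_iff:
  assumes "0 < n" and "0 \<le> x"
  shows "ereal (1 / real n) * neg_log x \<le> ereal r \<longleftrightarrow> exp (- (real n * r)) \<le> x"
proof (cases "x = 0")
  case False
  then have "0 < x" using assms by simp
  then show ?thesis
    using assms ln_le_cancel_iff[of "exp (- (real n * r))" x]
    by (auto simp: neg_log_def field_simps)
qed (use assms in \<open>simp add: neg_log_def not_le\<close>)

lemma eventually_linear_le_exp:
  assumes "0 < (c::real)"
  shows "eventually (\<lambda>n. real n + 1 \<le> exp (real n * c)) sequentially"
  using assms by real_asymp

text \<open>The slack between \<epsilon> and \<delta> yields an actual exponent \<open>l\<close>
  from the infimum without asking whether the infimum is attained.\<close>

lemma functional_le_of_D_max: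
  assumes "0 < n" and "ereal (1 / real n) * D_max H M \<rho> \<sigma> \<le> ereal \<epsilon>" and "\<epsilon> < \<delta>"
  shows "\<exists>l<real n * \<delta>. functional_le H M \<rho> (\<lambda>A. complex_of_real (exp l) * \<sigma> A)"
proof -
  have "D_max H M \<rho> \<sigma> < ereal (real n * \<delta>)"
  proof (cases "D_max H M \<rho> \<sigma>")
    case (real d)
    then have "d \<le> real n * \<epsilon>" using assms by (simp add: field_simps)
    also have "\<dots> < real n * \<delta>" using assms by simp
    finally show ?thesis using real by simp
  qed (use assms in auto)
  then show ?thesis
    unfolding D_max_def Inf_less_iff by auto
qed

text \<open>Source of the right-hand inequality: for one fixed test sequence the supremum over
  \<open>I\<close> dominates the exponent at \<open>i\<close>.\<close>

lemma sc_le_sc_relaxed: "i \<in> I \<Longrightarrow> sc H M r (\<lambda>n. \<rho> n i) S \<le> sc_relaxed H M r I \<rho> S"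
  unfolding sc_def sc_relaxed_def by (intro INF_mono) (meson SUP_upper)

section \<open>Test sequences of a given rate and their common average\<close>

locale hypothesis_testing =
  fixes H :: "nat \<Rightarrow> 'h::complex_hilbert set" and M :: "nat \<Rightarrow> 'h op set"
    and S :: "nat \<Rightarrow> 'h functional set"
  assumes vna: "von_neumann_algebra (H n) (M n)"
    and S_nonempty: "S n \<noteq> {}"
    and S_states: "\<sigma> \<in> S n \<Longrightarrow> is_state (H n) (M n) \<sigma>"
begin

lemma state_le_beta:
  assumes "\<sigma> \<in> S n" and T: "is_test (H n) (M n) T"
  shows "Re (\<sigma> T) \<le> beta (S n) T"
  \<comment> \<open>The supremum in \<open>beta\<close> is taken in the reals, so it needs an upper
    bound; states are at most 1 on tests.\<close>
  unfolding beta_def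
  by (intro cSUP_upper assms bdd_aboveI[of _ 1]) (auto intro: state_le_1[OF vna S_states T])

lemma beta_nonneg:
  assumes "is_test (H n) (M n) T"
  shows "0 \<le> beta (S n) T"
proof -
  obtain \<sigma> where "\<sigma> \<in> S n" using S_nonempty by blast
  then show ?thesis
    using state_nonneg[OF S_states assms] state_le_beta[OF _ assms] by (meson order.trans)
qed

text \<open>The strict gap between \<open>r\<close> and \<open>r'\<close> turns a bound on the limit
  inferior into a bound on almost all terms. This is where the passage to \<open>r' > r\<close> is
  used.\<close>

lemma beta_rate_eventually:
  assumes T: "T \<in> rate_tests H M S r'" and "r < r'"
  shows "eventually (\<lambda>n. beta (S n) (T n) \<le> exp (- (real n * r))) sequentially"
proof -
  have "ereal r < liminf (\<lambda>n. ereal (1 / real n) * neg_log (beta (S n) (T n)))"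
    using assms unfolding rate_tests_def by (auto intro: less_le_trans[of _ "ereal r'"])
  from less_LiminfD[OF this] eventually_gt_at_top[of 0] show ?thesis
  proof eventually_elim
    case (elim n)
    then show ?case
      using neg_log_rate_ge_iff[OF _ beta_nonneg, of n n "T n" r] T
      by (auto simp: rate_tests_def)
  qed
qed

lemma rate_testsI:
  assumes T: "\<And>n. is_test (H n) (M n) (T n)"
    and le: "\<And>n. beta (S n) (T n) \<le> exp (- (real n * r))"
  shows "T \<in> rate_tests H M S r"
proof -
  have "eventually (\<lambda>n. ereal r \<le> ereal (1 / real n) * neg_log (beta (S n) (T n))) sequentially"
    using eventually_gt_at_top[of 0]
    by eventually_elim (simp add: neg_log_rate_ge_iff beta_nonneg T le)
  then show ?thesis
    using T by (simp add: rate_tests_def Liminf_bounded)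
qed

lemma success_eventually:
  assumes T: "T \<in> rate_tests H M S r" and \<rho>: "\<And>n. is_state (H n) (M n) (\<rho> n)"
    and "success_exponent \<rho> T < ereal c"
  shows "eventually (\<lambda>n. exp (- (real n * c)) \<le> Re (\<rho> n (T n))) sequentially"
proof -
  have nonneg: "0 \<le> Re (\<rho> n (T n))" for n
    using T state_nonneg[OF \<rho>] by (simp add: rate_tests_def)
  have "eventually (\<lambda>n. ereal (1 / real n) * neg_log (Re (\<rho> n (T n))) < ereal c) sequentially"
    using assms(3) unfolding success_exponent_def by (rule Limsup_lessD)
  then show ?thesis
    using eventually_gt_at_top[of 0]
  proof eventually_elim
    case (elim n)
    then show ?case
      using neg_log_rate_le_iff[OF _ nonneg, of n n c] by (blast intro: less_imp_le)
  qed
qed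

lemma success_exponent_le:
  assumes T: "T \<in> rate_tests H M S r" and \<rho>: "\<And>n. is_state (H n) (M n) (\<rho> n)"
    and ev: "eventually (\<lambda>n. exp (- (real n * c)) \<le> Re (\<rho> n (T n))) sequentially"
  shows "success_exponent \<rho> T \<le> ereal c"
  unfolding success_exponent_def
proof (rule Limsup_bounded)
  have nonneg: "0 \<le> Re (\<rho> n (T n))" for n
    using T state_nonneg[OF \<rho>] by (simp add: rate_tests_def)
  show "eventually (\<lambda>n. ereal (1 / real n) * neg_log (Re (\<rho> n (T n))) \<le> ereal c) sequentially"
    using ev eventually_gt_at_top[of 0]
    by eventually_elim (simp add: neg_log_rate_le_iff nonneg)
qed

text \<open>The start of the error bound may depend on \<open>k\<close> without any uniformity,
  because sequences enter the average only at those times when they satisfy it. The comparison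
  factor \<open>n + 1\<close> is the same for all states.\<close>

lemma exists_common_test:
  fixes T :: "nat \<Rightarrow> nat \<Rightarrow> 'h op"
  assumes T: "\<And>k. T k \<in> rate_tests H M S r'" and "r < r'"
  obtains U where "U \<in> rate_tests H M S r"
    and "\<And>k. eventually (\<lambda>n. \<forall>\<phi>. is_state (H n) (M n) \<phi> \<longrightarrow>
      Re (\<phi> (T k n)) \<le> (real n + 1) * Re (\<phi> (U n))) sequentially"
proof -
  define K where "K n = {k. k \<le> n \<and> beta (S n) (T k n) \<le> exp (- (real n * r))}" for n
  \<comment> \<open>At most the \<open>n + 1\<close> indices \<open>0, ..., n\<close> take part, so
    the total weight never exceeds 1. If \<open>K n\<close> is empty, \<open>U n\<close> is the zero
    operator.\<close>
  define p where "p n = 1 / (real n + 1)" for n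
  define U where "U n = op_lincomb (H n) (K n) (\<lambda>_. p n) (\<lambda>k. T k n)" for n
  have test: "is_test (H n) (M n) (T k n)" for k n
    using T[of k] by (simp add: rate_tests_def)
  have TM: "T k n \<in> M n" for k n
    using test by (simp add: is_test_def)
  have K_sub: "K n \<subseteq> {..n}" for n
    by (auto simp: K_def)
  have fin: "finite (K n)" for n
    using K_sub finite_subset by blast
  have p_pos: "0 < p n" for n
    by (simp add: p_def)
  have "card (K n) \<le> n + 1" for n
    using card_mono[OF _ K_sub[of n]] by simp
  then have card: "real (card (K n)) * p n \<le> 1" for n
    unfolding p_def using of_nat_mono[of "card (K n)" "n + 1", where ?'a = real]
    by (simp add: field_simps)
  have U_test: "is_test (H n) (M n) (U n)" for n
    unfolding U_def using card[of n] p_pos[of n] test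
    by (intro is_test_op_lincomb[OF vna fin]) auto
  have \<phi>_U: "Re (\<phi> (U n)) = (\<Sum>k\<in>K n. p n * Re (\<phi> (T k n)))" if "is_state (H n) (M n) \<phi>" for \<phi> n
    using positive_linear_functional_lincomb[OF vna _ fin, of n \<phi> n "\<lambda>k. T k n" "\<lambda>_. p n"] that TM
    by (simp add: U_def is_state_def)
  \<comment> \<open>Selection through \<open>K n\<close> gives this bound at every \<open>n\<close>,
    not just eventually.\<close>
  have "beta (S n) (U n) \<le> exp (- (real n * r))" for n
    unfolding beta_def
  proof (rule cSUP_least[OF S_nonempty])
    fix \<sigma> assume \<sigma>: "\<sigma> \<in> S n"
    have "Re (\<sigma> (U n)) = (\<Sum>k\<in>K n. p n * Re (\<sigma> (T k n)))"
      using \<phi>_U S_states[OF \<sigma>] by blast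
    also have "\<dots> \<le> (\<Sum>k\<in>K n. p n * exp (- (real n * r)))"
      using p_pos[of n] state_le_beta[OF \<sigma> test]
      by (intro sum_mono mult_left_mono) (auto simp: K_def intro: order.trans)
    also have "\<dots> \<le> exp (- (real n * r))"
      using mult_right_mono[OF card[of n], of "exp (- (real n * r))"] by (simp add: mult.assoc)
    finally show "Re (\<sigma> (U n)) \<le> exp (- (real n * r))" .
  qed
  then have "U \<in> rate_tests H M S r"
    by (intro rate_testsI U_test)
  moreover have "eventually (\<lambda>n. \<forall>\<phi>. is_state (H n) (M n) \<phi> \<longrightarrow>
      Re (\<phi> (T k n)) \<le> (real n + 1) * Re (\<phi> (U n))) sequentially" for k
    using beta_rate_eventually[OF T[of k] \<open>r < r'\<close>] eventually_ge_at_top[of k]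
  proof eventually_elim
    case (elim n)
    then have k: "k \<in> K n" by (simp add: K_def)
    show ?case
    proof (intro allI impI)
      fix \<phi> assume \<phi>: "is_state (H n) (M n) \<phi>"
      \<comment> \<open>All summands are nonnegative, so the other sequences can only increase the
        success probability.\<close>
      have "p n * Re (\<phi> (T k n)) \<le> (\<Sum>k\<in>K n. p n * Re (\<phi> (T k n)))"
        using p_pos[of n] state_nonneg[OF \<phi> test]
        by (intro member_le_sum[OF k _ fin]) simp
      then show "Re (\<phi> (T k n)) \<le> (real n + 1) * Re (\<phi> (U n))"
        unfolding \<phi>_U[OF \<phi>, symmetric] by (simp add: p_def field_simps)
    qed
  qed
  ultimately show ?thesis using that by blast
qed

text \<open>The strict bound by \<open>c\<close> provides a test sequence for each \<open>k\<close>
  in \<open>J\<close>; their common average \<open>U\<close> then serves all of \<open>I\<close> at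
  once, up to an arbitrarily small loss.\<close>

lemma sc_relaxed_le:
  fixes I J :: "'i set"
  assumes I: "I \<noteq> {}" and J: "countable J" "J \<subseteq> I"
    and \<rho>: "\<And>n i. i \<in> I \<Longrightarrow> is_state (H n) (M n) (\<rho> n i)"
    and approx: "\<And>i (\<epsilon>::real). i \<in> I \<Longrightarrow> \<epsilon> > 0 \<Longrightarrow>
      \<exists>k\<in>J. \<exists>N. \<forall>n\<ge>N. ereal (1 / real n) * D_max (H n) (M n) (\<rho> n k) (\<rho> n i) \<le> ereal \<epsilon>"
    and "r < r'" and c: "\<And>k. k \<in> J \<Longrightarrow> sc H M r' (\<lambda>n. \<rho> n k) S < ereal c"
  shows "sc_relaxed H M r I \<rho> S \<le> ereal c"
proof -
  \<comment> \<open>Approximating any element of \<open>I\<close> with \<epsilon> equal to 1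
    produces an element of \<open>J\<close>. The enumeration below may repeat elements, which is
    harmless.\<close>
  have "J \<noteq> {}"
    using I approx zero_less_one by blast
  then have f: "range (from_nat_into J) = J"
    using J(1) by (simp add: range_from_nat_into)
  have "\<exists>T\<in>rate_tests H M S r'. success_exponent (\<lambda>n. \<rho> n k) T < ereal c" if "k \<in> J" for k
    using c[OF that] by (simp add: sc_def INF_less_iff)
  then have "\<forall>m. \<exists>T. T \<in> rate_tests H M S r' \<and>
      success_exponent (\<lambda>n. \<rho> n (from_nat_into J m)) T < ereal c"
    using from_nat_into[OF \<open>J \<noteq> {}\<close>] by blast
  from choice[OF this] obtain T where T: "\<And>m. T m \<in> rate_tests H M S r'"
      "\<And>m. success_exponent (\<lambda>n. \<rho> n (from_nat_into J m)) (T m) < ereal c"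
    by blast
  obtain U where U: "U \<in> rate_tests H M S r"
    and TU: "\<And>m. eventually (\<lambda>n. \<forall>\<phi>. is_state (H n) (M n) \<phi> \<longrightarrow>
      Re (\<phi> (T m n)) \<le> (real n + 1) * Re (\<phi> (U n))) sequentially"
    by (rule exists_common_test[of T, OF T(1) \<open>r < r'\<close>]) (rule that)
  have U_test: "is_test (H n) (M n) (U n)" for n
    using U by (simp add: rate_tests_def)
  have bound: "success_exponent (\<lambda>n. \<rho> n i) U \<le> ereal (c + \<epsilon>)" if i: "i \<in> I" and \<epsilon>: "0 < \<epsilon>" for i \<epsilon>
  proof (rule success_exponent_le[OF U \<rho>[OF i]])
    \<comment> \<open>Budget: one third of \<epsilon> absorbs the factor \<open>n + 1\<close>, and
      two thirds cover the domination, namely \<open>D_max\<close> plus the slack of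
      \<open>functional_le_of_D_max\<close>.\<close>
    have "0 < \<epsilon> / 3" using \<epsilon> by simp
    then obtain k N where k: "k \<in> J"
      and D: "\<And>n. N \<le> n \<Longrightarrow>
        ereal (1 / real n) * D_max (H n) (M n) (\<rho> n k) (\<rho> n i) \<le> ereal (\<epsilon> / 3)"
      using approx[OF i] by blast
    obtain m where m: "k = from_nat_into J m" using k f by blast
    have \<rho>k: "is_state (H n) (M n) (\<rho> n k)" for n using \<rho> J k by blast
    have "eventually (\<lambda>n. exp (- (real n * c)) \<le> Re (\<rho> n k (T m n))) sequentially"
      using success_eventually[OF T(1) \<rho>k] T(2)[of m] m by blast
    moreover have "eventually (\<lambda>n. real n + 1 \<le> exp (real n * (\<epsilon> / 3))) sequentially"
      by (rule eventually_linear_le_exp) (use \<epsilon> in simp)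
    ultimately show "eventually (\<lambda>n. exp (- (real n * (c + \<epsilon>))) \<le> Re (\<rho> n i (U n))) sequentially"
      using TU[of m] eventually_gt_at_top[of 0] eventually_ge_at_top[of N]
    proof eventually_elim
      case (elim n)
      obtain l where l: "l < real n * (2 * \<epsilon> / 3)"
        and le: "functional_le (H n) (M n) (\<rho> n k) (\<lambda>A. complex_of_real (exp l) * \<rho> n i A)"
        using functional_le_of_D_max[OF _ D, of n "2 * \<epsilon> / 3"] elim \<epsilon> by auto
      have nonneg: "0 \<le> Re (\<rho> n i (U n))" by (rule state_nonneg[OF \<rho>[OF i] U_test])
      have "exp (- (real n * c)) \<le> (real n + 1) * Re (\<rho> n k (U n))"
        using elim \<rho>k by (meson order.trans)
      also have "\<dots> \<le> (real n + 1) * (exp l * Re (\<rho> n i (U n)))"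
        using le U_test
        by (intro mult_left_mono)
          (auto simp: functional_le_def is_test_def complex_nonneg_Reals_iff)
      also have "\<dots> \<le> exp (real n * (\<epsilon> / 3)) * (exp (real n * (2 * \<epsilon> / 3)) * Re (\<rho> n i (U n)))"
        using elim l nonneg by (intro mult_mono) auto
      also have "\<dots> = exp (real n * \<epsilon>) * Re (\<rho> n i (U n))"
        unfolding mult.assoc[symmetric] exp_add[symmetric] by (simp flip: distrib_left)
      \<comment> \<open>The left side is \<open>exp (- (real n * c))\<close> rewritten so that the
        positive factor \<open>exp (real n * \<epsilon>)\<close> cancels.\<close>
      finally have "exp (real n * \<epsilon>) * exp (- (real n * (c + \<epsilon>)))
          \<le> exp (real n * \<epsilon>) * Re (\<rho> n i (U n))"
        by (simp add: distrib_left flip: exp_add)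
      then show ?case by simp
    qed
  qed
  have "success_exponent (\<lambda>n. \<rho> n i) U \<le> ereal c" if "i \<in> I" for i
    by (rule ereal_le_epsilon2) (simp add: bound[OF that])
  then show ?thesis
    unfolding sc_relaxed_def by (intro INF_lower2[OF U] SUP_least)
qed

end

theorem propositionV4:
  fixes H :: "nat \<Rightarrow> 'h::complex_hilbert set"
    and M :: "nat \<Rightarrow> 'h op set"
    and I J :: "'i set"
    and \<rho> :: "nat \<Rightarrow> 'i \<Rightarrow> 'h functional"
    and S :: "nat \<Rightarrow> 'h functional set"
    and r :: real
  assumes "\<And>n. von_neumann_algebra (H n) (M n)"
    and "I \<noteq> {}"
    and "\<And>n i. i \<in> I \<Longrightarrow> is_state (H n) (M n) (\<rho> n i)"
    and "\<And>n. S n \<noteq> {}"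
    and "\<And>n \<sigma>. \<sigma> \<in> S n \<Longrightarrow> is_state (H n) (M n) \<sigma>"
    and "countable J" and "J \<subseteq> I"
    and "\<And>i (\<epsilon>::real). i \<in> I \<Longrightarrow> \<epsilon> > 0 \<Longrightarrow>
      \<exists>k\<in>J. \<exists>N. \<forall>n\<ge>N. ereal (1 / real n) * D_max (H n) (M n) (\<rho> n k) (\<rho> n i) \<le> ereal \<epsilon>"
    and "r > 0"
  shows "(INF r'\<in>{r<..}. SUP i\<in>J. sc H M r' (\<lambda>n. \<rho> n i) S) \<ge> sc_relaxed H M r I \<rho> S \<and>
    sc_relaxed H M r I \<rho> S \<ge> (SUP i\<in>I. sc H M r (\<lambda>n. \<rho> n i) S)"
proof (intro conjI INF_greatest SUP_least sc_le_sc_relaxed)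
  fix r' assume "r' \<in> {r<..}"
  then have "r < r'" by simp
  interpret hypothesis_testing H M S
    using assms(1,4,5) by unfold_locales
  show "sc_relaxed H M r I \<rho> S \<le> (SUP i\<in>J. sc H M r' (\<lambda>n. \<rho> n i) S)"
  \<comment> \<open>Testing against real upper bounds \<open>c\<close> of the supremum also covers
    its infinite values; the extra \<epsilon> then supplies the strict inequality that
    \<open>sc_relaxed_le\<close> asks for.\<close>
  proof (rule ereal_le_real)
    show "sc_relaxed H M r I \<rho> S \<le> ereal c" if "(SUP i\<in>J. sc H M r' (\<lambda>n. \<rho> n i) S) \<le> ereal c" for c
    proof (rule ereal_le_epsilon2)
      fix \<epsilon> :: real assume "0 < \<epsilon>"
      have "sc H M r' (\<lambda>n. \<rho> n k) S < ereal (c + \<epsilon>)" if "k \<in> J" for k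
        using SUP_upper[OF that, of "\<lambda>i. sc H M r' (\<lambda>n. \<rho> n i) S"] \<open>_ \<le> ereal c\<close> \<open>0 < \<epsilon>\<close>
        by (auto intro: le_less_trans[of _ "ereal c"])
      then show "sc_relaxed H M r I \<rho> S \<le> ereal c + ereal \<epsilon>"
        using sc_relaxed_le[OF assms(2,6,7,3,8) \<open>r < r'\<close>] by simp
    qed
  qed
qed

end
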